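(* Let $X$ be a finite set with at least three elements and let $\mathcal{P}$ be an $(m,k)$-partition of $X$ having exactly $m_i$ blocks of size $n_i$ for each $i\in I_k$, where $n_1<n_2<\cdots<n_k$ and $m=m_1+\cdots+m_k$. Then \[|\mathrm{Reg}(\Gamma(X,\mathcal{P}))|=\sum_{r=1}^m\sum_{t=1}^{\mu_r}\Bigg((r_{t_1}!)\,S(m_1,r_{t_1})\,(n_1!)^{m_1}\prod_{i=2}^k\Bigg(\sum_{p=r_{t_i}}^{m_i}\binom{m_i}{p}(r_{t_i}!)\,S(p,r_{t_i})\,(n_i!)^p\Big(\sum_{j=1}^{i-1}r_{t_j}\,(n_j!)\,S(n_i,n_j)\Big)^{m_i-p}\Bigg)\Bigg),\] where, for each $r\in I_m$, $\mathfrak{F}_r=\{\mathcal{Q}_{r1},\dots,\mathcal{Q}_{r\mu_r}\}$ is the collection of all $r$-subpartitions of $\mathcal{P}$ containing at least one block of size $n_1$, $\mu_r=|\mathfrak{F}_r|$, and $r_{t_i}\ge 0$ is the number of blocks of size $n_i$ in $\mathcal{Q}_{rt}\in\mathfrak{F}_r$ for each $i\in I_k$.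
   Context: $I_k=\{1,\dots,k\}$ and $I_m=\{1,\dots,m\}$. A partition of $X$ is a collection of nonempty pairwise disjoint subsets (blocks) with union $X$. For positive integers $m\ge k$, an $(m,k)$-partition is a partition with exactly $m$ blocks whose blocks have exactly $k$ distinct sizes. An $r$-subpartition of $\mathcal{P}$ is a subcollection of $\mathcal{P}$ consisting of $r$ blocks. $\Gamma(X,\mathcal{P})$ is the semigroup (under composition) of all maps $f\colon X\to X$ such that for every block $X_i\in\mathcal{P}$ there is a block $X_j\in\mathcal{P}$ with $X_if=X_j$, where $X_if$ denotes the image of $X_i$ under $f$. An element $a$ of a semigroup $S$ is regular if $a=aba$ for some $b\in S$; $\mathrm{Reg}(S)$ is the set of regular elements of $S$. $S(a,b)$ denotes the Stirling number of the second kind, the number of partitions of an $a$-element set into $b$ blocks, with the usual conventions $S(0,0)=1$ and $S(a,0)=0$ for $a>0$. Empty products are $1$. *)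

theory Defs
  imports
    "HOL-Algebra.Group"
    "HOL-Library.Disjoint_Sets"
    "HOL-Combinatorics.Stirling"
begin

definition mk_partition :: "nat \<Rightarrow> nat \<Rightarrow> 'a set \<Rightarrow> 'a set set \<Rightarrow> bool" where
  "mk_partition m k X P \<longleftrightarrow>
     0 < k \<and> k \<le> m \<and> partition_on X P \<and> card P = m \<and> card (card ` P) = k"

definition subpartitions :: "nat \<Rightarrow> 'a set set \<Rightarrow> 'a set set set" where
  "subpartitions r P = {Q. Q \<subseteq> P \<and> card Q = r}"

definition blocks_of_size :: "'a set set \<Rightarrow> nat \<Rightarrow> 'a set set" where
  "blocks_of_size Q s = {B \<in> Q. card B = s}"

text \<open>Maps from \<open>X\<close> to \<open>X\<close> are taken extensionally, so that each is counted once. Maps act on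
  the right: in the product \<open>f \<otimes> g\<close> the map \<open>f\<close> is applied first. The identity is
  only there to fill the unit field of the record.\<close>

definition Gamma :: "'a set \<Rightarrow> 'a set set \<Rightarrow> ('a \<Rightarrow> 'a) monoid" where
  "Gamma X P =
     \<lparr>carrier = {f \<in> X \<rightarrow>\<^sub>E X. \<forall>B\<in>P. \<exists>C\<in>P. f ` B = C},
      mult = (\<lambda>f g. compose X g f),
      one = restrict id X\<rparr>"

definition Reg :: "('a, 'b) monoid_scheme \<Rightarrow> 'a set" where
  "Reg S = {a \<in> carrier S. \<exists>b\<in>carrier S. a = a \<otimes>\<^bsub>S\<^esub> b \<otimes>\<^bsub>S\<^esub> a}"

lemma monoid_Gamma:
  assumes "partition_on X P"
  shows "monoid (Gamma X P)"
proof -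
  have sub: "B \<subseteq> X" if "B \<in> P" for B
    using assms that by (auto simp: partition_on_def)
  have comp: "compose X g f ` B = g ` f ` B" if "B \<in> P" for f g :: "'a \<Rightarrow> 'a" and B
    using sub[OF that] by (auto simp: compose_def image_iff)
  have one: "restrict id X ` B = B" if "B \<in> P" for B
    using sub[OF that] by (auto simp: image_iff)
  show ?thesis
  proof
    fix f g assume "f \<in> carrier (Gamma X P)" "g \<in> carrier (Gamma X P)"
    then show "f \<otimes>\<^bsub>Gamma X P\<^esub> g \<in> carrier (Gamma X P)"
      by (auto simp: Gamma_def comp) (auto simp: compose_def)
  next
    fix f g h assume "f \<in> carrier (Gamma X P)"
    then show "f \<otimes>\<^bsub>Gamma X P\<^esub> g \<otimes>\<^bsub>Gamma X P\<^esub> h = f \<otimes>\<^bsub>Gamma X P\<^esub> (g \<otimes>\<^bsub>Gamma X P\<^esub> h)"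
      by (auto simp: Gamma_def compose_def fun_eq_iff)
  next
    show "\<one>\<^bsub>Gamma X P\<^esub> \<in> carrier (Gamma X P)"
      unfolding Gamma_def partial_object.simps monoid.simps using one by fastforce
  next
    fix f assume "f \<in> carrier (Gamma X P)"
    then show "\<one>\<^bsub>Gamma X P\<^esub> \<otimes>\<^bsub>Gamma X P\<^esub> f = f" "f \<otimes>\<^bsub>Gamma X P\<^esub> \<one>\<^bsub>Gamma X P\<^esub> = f"
      by (auto simp: Gamma_def compose_def fun_eq_iff PiE_def extensional_def)
  qed
qed

text \<open>The library defines \<^const>\<open>Stirling\<close> by recursion; it does count set partitions.\<close>

lemma card_partitions_Stirling:
  assumes "finite A"
  shows "card {P. partition_on A P \<and> card P = k} = Stirling (card A) k"
  using assms
proof (induction A arbitrary: k rule: finite_induct)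
  case empty
  show ?case
  proof (cases k)
    case 0
    then have "{P::'a set set. partition_on {} P \<and> card P = k} = {{}}"
      by (auto simp: partition_on_empty)
    then show ?thesis using 0 by simp
  next
    case (Suc k')
    then have "{P::'a set set. partition_on {} P \<and> card P = k} = {}"
      by (auto simp: partition_on_empty)
    then show ?thesis using Suc by (metis Stirling.simps(2) card.empty)
  qed
next
  case (insert x A)
  let ?p = "\<lambda>A k. {P. partition_on A P \<and> card P = k}"
  have fin_parts: "finite (?p A k)" for k
    by (rule finite_subset[OF _ finitely_many_partition_on[OF insert.hyps(1)]]) auto
  have finP: "finite P" if "partition_on A P" for P
    using finite_elements insert.hyps(1) that by blast
  have finP': "finite P" if "partition_on (insert x A) P" for P
    using finite_elements insert.hyps(1) that by blast
  show ?case
  proof (cases k)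
    case 0
    have "card P \<noteq> 0" if "partition_on (insert x A) P" for P
      using finP'[OF that] that by (auto simp: partition_on_def)
    then have "?p (insert x A) 0 = {}" by blast
    then show ?thesis
      using 0 insert.hyps by (metis Stirling.simps(3) card.empty card_insert_disjoint)
  next
    case (Suc k')
    define f where "f = (\<lambda>P::'a set set. insert {x} P)"
    define g where "g = (\<lambda>(P::'a set set, B). insert (insert x B) (P - {B}))"
    let ?S = "Sigma (?p A (Suc k')) (\<lambda>P. P)"
    have xnot: "x \<notin> B" if "partition_on A P" "B \<in> P" for P B
      using insert.hyps(2) that by (auto simp: partition_on_def)
    have f_in: "f P \<in> ?p (insert x A) (Suc k')" if "P \<in> ?p A k'" for P
    proof -
      have *: "partition_on A P" "card P = k'" using that by auto
      have "{x} \<notin> P" using xnot[OF *(1)] by blast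
      moreover have "insert x A - {x} = A" using insert.hyps(2) by auto
      moreover have "disjnt {x} (\<Union>P)"
        using xnot[OF *(1)] by (auto simp: disjnt_def)
      ultimately show ?thesis
        using * finP[OF *(1)] by (auto simp: f_def partition_on_def pairwise_insert disjnt_def)
    qed
    have g_in: "g (P, B) \<in> ?p (insert x A) (Suc k')" if "P \<in> ?p A (Suc k')" "B \<in> P" for P B
    proof -
      have *: "partition_on A P" "card P = Suc k'" using that by auto
      have U: "\<Union>P = A" and D: "disjoint P" and E: "{} \<notin> P"
        using *(1) by (auto simp: partition_on_def)
      have n: "insert x B \<notin> P" using xnot[OF *(1)] by blast
      have "card (insert (insert x B) (P - {B})) = Suc k'"
        using n * finP[OF *(1)] that(2) by (simp add: card_insert_if)
      moreover have "disjoint (insert (insert x B) (P - {B}))"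
      proof -
        have "disjnt (insert x B) C" if "C \<in> P - {B}" for C
          using D \<open>B \<in> P\<close> that xnot[OF *(1), of C] by (auto simp: pairwise_def disjnt_def)
        then show ?thesis
          using D by (auto simp: pairwise_insert disjnt_sym pairwise_def)
      qed
      moreover have "\<Union>(insert (insert x B) (P - {B})) = insert x A"
        using U that(2) by auto
      ultimately show ?thesis using E by (auto simp: g_def partition_on_def)
    qed
    have onto: "Q \<in> f ` ?p A k' \<union> g ` ?S" if "Q \<in> ?p (insert x A) (Suc k')" for Q
    proof -
      have *: "partition_on (insert x A) Q" "card Q = Suc k'" using that by auto
      have U: "\<Union>Q = insert x A" and D: "disjoint Q" and E: "{} \<notin> Q"
        using *(1) by (auto simp: partition_on_def)
      have fQ: "finite Q" using finP'[OF *(1)] .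
      obtain C where C: "C \<in> Q" "x \<in> C" using U by blast
      have other: "x \<notin> E" "E \<inter> C = {}" if "E \<in> Q" "E \<noteq> C" for E
        using D C that by (auto simp: pairwise_def disjnt_def)
      have rest: "\<Union>(Q - {C}) = insert x A - C"
      proof
        show "\<Union>(Q - {C}) \<subseteq> insert x A - C"
          unfolding U[symmetric] using other(2) by fastforce
        show "insert x A - C \<subseteq> \<Union>(Q - {C})"
          unfolding U[symmetric] by blast
      qed
      show ?thesis
      proof (cases "C = {x}")
        case True
        have "\<Union>(Q - {C}) = A"
          using rest True insert.hyps(2) by simp
        then have "Q - {C} \<in> ?p A k'"
          using D E *(2) C fQ by (auto simp: partition_on_def pairwise_def)
        moreover have "Q = f (Q - {C})" using C True by (auto simp: f_def)
        ultimately show ?thesis by blast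
      next
        case False
        define B where "B = C - {x}"
        have B: "C = insert x B" "x \<notin> B" "B \<noteq> {}" using C False by (auto simp: B_def)
        have Bn: "B \<notin> Q" using other(2)[of B] B C(2) by blast
        define P where "P = insert B (Q - {C})"
        have "\<Union>P = A"
        proof -
          have "\<Union>P = B \<union> (insert x A - C)" unfolding P_def using rest by simp
          moreover have "C \<subseteq> insert x A" unfolding U[symmetric] using C(1) by blast
          ultimately show ?thesis using insert.hyps(2) B(1,2) by blast
        qed
        moreover have "disjoint P"
        proof -
          have "disjnt B E" if "E \<in> Q - {C}" for E
            using other(2)[of E] that B by (auto simp: disjnt_def)
          then show ?thesis
            using D unfolding P_def by (auto simp: pairwise_insert disjnt_sym pairwise_def)
        qed
        moreover have "card P = Suc k'"
          using *(2) Bn C fQ by (simp add: P_def card_insert_if)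
        ultimately have "P \<in> ?p A (Suc k')"
          using E B by (auto simp: partition_on_def P_def)
        moreover have "Q = g (P, B)"
          using C Bn B by (auto simp: g_def P_def)
        moreover have "B \<in> P" by (simp add: P_def)
        ultimately show ?thesis by blast
      qed
    qed
    have eq: "?p (insert x A) (Suc k') = f ` ?p A k' \<union> g ` ?S"
      using f_in g_in onto by blast
    have dj: "f ` ?p A k' \<inter> g ` ?S = {}"
    proof -
      have False if "P \<in> ?p A k'" "P' \<in> ?p A (Suc k')" "B \<in> P'" "f P = g (P', B)" for P P' B
      proof -
        have "{x} \<in> g (P', B)" using that(4) by (auto simp: f_def)
        moreover have "{x} \<notin> P'" using xnot that(2) by blast
        ultimately have "{x} = insert x B" by (auto simp: g_def)
        moreover have "x \<notin> B" "B \<noteq> {}" using that xnot by (auto simp: partition_on_def)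
        ultimately show False by blast
      qed
      then show ?thesis by blast
    qed
    have inj_f: "inj_on f (?p A k')"
    proof (rule inj_onI)
      fix P P' assume "P \<in> ?p A k'" "P' \<in> ?p A k'" "f P = f P'"
      moreover from this have "{x} \<notin> P" "{x} \<notin> P'" using xnot by blast+
      ultimately show "P = P'" by (metis f_def insert_ident)
    qed
    have inj_g: "inj_on g ?S"
    proof (rule inj_onI)
      fix u v assume u: "u \<in> ?S" and v: "v \<in> ?S" and eq: "g u = g v"
      obtain P B P' B' where uv: "u = (P, B)" "v = (P', B')" by (cases u, cases v)
      have P: "partition_on A P" "B \<in> P" "partition_on A P'" "B' \<in> P'"
        using u v uv by auto
      have e: "insert (insert x B) (P - {B}) = insert (insert x B') (P' - {B'})"
        using eq uv by (simp add: g_def)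
      have "insert x B = insert x B'"
        using e xnot[OF P(3)] by blast
      then have B: "B = B'" using xnot[OF P(1,2)] xnot[OF P(3,4)] by auto
      have "insert x B \<notin> P" "insert x B \<notin> P'" using xnot P by blast+
      then have "P - {B} = P' - {B}" using e B by (metis DiffD1 insert_ident)
      then have "P = P'" using P B by (metis insert_Diff)
      then show "u = v" using B uv by simp
    qed
    have "card ?S = Suc k' * card (?p A (Suc k'))"
    proof -
      have "card ?S = (\<Sum>P\<in>?p A (Suc k'). card P)"
        using fin_parts finP by (intro card_SigmaI) auto
      also have "\<dots> = (\<Sum>P\<in>?p A (Suc k'). Suc k')"
        by (intro sum.cong) auto
      finally show ?thesis by simp
    qed
    moreover have "finite ?S"
      using fin_parts finP by (intro finite_SigmaI) auto
    ultimately have "card (?p (insert x A) (Suc k')) = card (?p A k') + Suc k' * card (?p A (Suc k'))"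
      unfolding eq using dj inj_f inj_g fin_parts
      by (subst card_Un_disjoint) (auto simp only: finite_imageI card_image)
    then show ?thesis
      using Suc insert by simp
  qed
qed

end

theory Submission
  imports Defs
begin

text \<open>
  A map \<open>f\<close> in \<open>\<Gamma>(X, P)\<close> induces a map \<open>B \<mapsto> f ` B\<close> on the blocks. It is regular exactly
  when every image block is also the image of a block of its own cardinality
  (\<open>Reg_Gamma_eq\<close>): if \<open>f = f b f\<close>, then \<open>b\<close> carries an image block to a block that \<open>f\<close> maps
  back onto it; a surjection cannot raise the cardinality, and the round trip ends where it began,
  so both steps preserve it. Conversely \<open>f\<close> is bijective from such a block onto its image, and the
  inverse bijections make up a \<open>b\<close>.

  So one fixes the set \<open>Q\<close> of image blocks and counts block maps \<open>\<phi>\<close> with image \<open>Q\<close> that satisfy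
  this condition, weighted by the number of \<open>f\<close> inducing them. Such an \<open>f\<close> is an independent
  choice of a surjection \<open>B \<rightarrow> \<phi> B\<close> for each block \<open>B\<close>, and a \<open>b\<close>-element set has
  \<open>c! S(b, c)\<close> surjections onto a \<open>c\<close>-element set. The condition on \<open>\<phi>\<close> says, separately for
  each size, that the blocks of \<open>P\<close> of that size cover the blocks of \<open>Q\<close> of that size, so the
  weighted count is a product over the sizes (\<open>sum_block_maps\<close>). In the factor of the size
  \<open>n i\<close>, let \<open>p\<close> be the number of blocks that go to blocks of the same size: these are chosen,
  sent onto the \<open>r i\<close> blocks of \<open>Q\<close> of that size, and each by one of \<open>(n i)!\<close> bijections; each of the
  remaining \<open>m i - p\<close> blocks goes to any smaller block of \<open>Q\<close>, by any surjection. Larger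
  blocks contribute nothing, as there is no surjection onto them.

  For the smallest size there is no smaller block, so only \<open>p = m 1\<close> remains and the factor is
  \<open>r 1! S(m 1, r 1) (n 1!) ^ m 1\<close>. It is zero if \<open>r 1 = 0\<close>, which is why only those \<open>Q\<close> count
  that contain a block of minimal size.
\<close>

section \<open>Functions on a disjoint union\<close>

text \<open>A function on a disjoint union is the same as a family of functions on the parts, so a sum of
  products of terms that each look at one part is a product of sums.\<close>

lemma sum_prod_PiE_UN:
  fixes g :: "'i \<Rightarrow> ('a \<Rightarrow> 'b) \<Rightarrow> 'c::comm_semiring_1"
  assumes I: "finite I" and A: "\<And>i. i \<in> I \<Longrightarrow> finite (A i)"
    and disj: "disjoint_family_on A I" and T: "finite T"
  shows "(\<Sum>\<phi>\<in>(\<Union>i\<in>I. A i) \<rightarrow>\<^sub>E T. \<Prod>i\<in>I. g i (restrict \<phi> (A i))) =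
    (\<Prod>i\<in>I. \<Sum>\<psi>\<in>A i \<rightarrow>\<^sub>E T. g i \<psi>)"
proof -
  define idx where "idx x = (THE i. i \<in> I \<and> x \<in> A i)" for x
  have idx: "idx x = i" if "i \<in> I" "x \<in> A i" for x i
    unfolding idx_def using that disj by (intro the_equality) (auto simp: disjoint_family_on_def)
  have "(\<Prod>i\<in>I. \<Sum>\<psi>\<in>A i \<rightarrow>\<^sub>E T. g i \<psi>) =
      (\<Sum>G\<in>(\<Pi>\<^sub>E i\<in>I. A i \<rightarrow>\<^sub>E T). \<Prod>i\<in>I. g i (G i))"
    using I A T by (intro prod_sum_PiE) (auto intro: finite_PiE)
  also have "\<dots> = (\<Sum>\<phi>\<in>(\<Union>i\<in>I. A i) \<rightarrow>\<^sub>E T. \<Prod>i\<in>I. g i (restrict \<phi> (A i)))"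
  proof (rule sum.reindex_bij_witness[where
        i = "\<lambda>\<phi>. \<lambda>i\<in>I. restrict \<phi> (A i)" and
        j = "\<lambda>G. \<lambda>x\<in>(\<Union>i\<in>I. A i). G (idx x) x"])
    fix G assume G: "G \<in> (\<Pi>\<^sub>E i\<in>I. A i \<rightarrow>\<^sub>E T)"
    have res: "restrict (\<lambda>x\<in>(\<Union>i\<in>I. A i). G (idx x) x) (A i) = G i" if "i \<in> I" for i
    proof
      fix x show "restrict (\<lambda>x\<in>(\<Union>i\<in>I. A i). G (idx x) x) (A i) x = G i x"
        using G that idx[OF that, of x] by (auto simp: PiE_def Pi_def extensional_def)
    qed
    show "(\<lambda>i\<in>I. restrict (\<lambda>x\<in>(\<Union>i\<in>I. A i). G (idx x) x) (A i)) = G"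
    proof
      fix i show "(\<lambda>i\<in>I. restrict (\<lambda>x\<in>(\<Union>i\<in>I. A i). G (idx x) x) (A i)) i = G i"
        using G res[of i] by (auto simp: PiE_def extensional_def)
    qed
    show "(\<lambda>x\<in>(\<Union>i\<in>I. A i). G (idx x) x) \<in> (\<Union>i\<in>I. A i) \<rightarrow>\<^sub>E T"
      using G by (auto simp: idx PiE_def Pi_def)
    show "(\<Prod>i\<in>I. g i (restrict (\<lambda>x\<in>(\<Union>i\<in>I. A i). G (idx x) x) (A i))) = (\<Prod>i\<in>I. g i (G i))"
      using res by (intro prod.cong) auto
  next
    fix \<phi> assume \<phi>: "\<phi> \<in> (\<Union>i\<in>I. A i) \<rightarrow>\<^sub>E T"
    show "(\<lambda>x\<in>(\<Union>i\<in>I. A i). (\<lambda>i\<in>I. restrict \<phi> (A i)) (idx x) x) = \<phi>"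
    proof
      fix x show "(\<lambda>x\<in>(\<Union>i\<in>I. A i). (\<lambda>i\<in>I. restrict \<phi> (A i)) (idx x) x) x = \<phi> x"
      proof (cases "x \<in> (\<Union>i\<in>I. A i)")
        case True
        then obtain i where "i \<in> I" "x \<in> A i" by blast
        then show ?thesis using idx[of i x] by auto
      next
        case False
        then show ?thesis using PiE_arb[OF \<phi>] by simp
      qed
    qed
    show "(\<lambda>i\<in>I. restrict \<phi> (A i)) \<in> (\<Pi>\<^sub>E i\<in>I. A i \<rightarrow>\<^sub>E T)"
      using \<phi> by (auto simp: PiE_def Pi_def)
  qed
  finally show ?thesis by simp
qed

lemma prod_of_bool:
  "finite I \<Longrightarrow> (\<Prod>i\<in>I. of_bool (R i)) = (of_bool (\<forall>i\<in>I. R i) :: 'c::comm_semiring_1)"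
  by (induction I rule: finite_induct) auto

lemma card_PiE_UN:
  assumes I: "finite I" and A: "\<And>i. i \<in> I \<Longrightarrow> finite (A i)"
    and disj: "disjoint_family_on A I" and T: "finite T"
  shows "card {\<phi> \<in> (\<Union>i\<in>I. A i) \<rightarrow>\<^sub>E T. \<forall>i\<in>I. R i (restrict \<phi> (A i))} =
    (\<Prod>i\<in>I. card {\<psi> \<in> A i \<rightarrow>\<^sub>E T. R i \<psi>})"
proof -
  have fin: "finite ((\<Union>i\<in>I. A i) \<rightarrow>\<^sub>E T)" using I A T by (auto intro!: finite_PiE)
  have fin': "finite (A i \<rightarrow>\<^sub>E T)" if "i \<in> I" for i using that A T by (auto intro!: finite_PiE)
  have "card {\<phi> \<in> (\<Union>i\<in>I. A i) \<rightarrow>\<^sub>E T. \<forall>i\<in>I. R i (restrict \<phi> (A i))} =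
     (\<Sum>\<phi>\<in>(\<Union>i\<in>I. A i) \<rightarrow>\<^sub>E T. \<Prod>i\<in>I. of_bool (R i (restrict \<phi> (A i))))"
    using fin by (simp add: prod_of_bool[OF I] Int_def)
  also have "\<dots> = (\<Prod>i\<in>I. \<Sum>\<psi>\<in>A i \<rightarrow>\<^sub>E T. of_bool (R i \<psi>))"
    by (rule sum_prod_PiE_UN[OF assms, where g = "\<lambda>i \<psi>. of_bool (R i \<psi>)"])
  also have "\<dots> = (\<Prod>i\<in>I. card {\<psi> \<in> A i \<rightarrow>\<^sub>E T. R i \<psi>})"
    using fin' by (intro prod.cong) (auto simp: Int_def)
  finally show ?thesis .
qed

section \<open>Counting surjections\<close>

text \<open>The recursion of the Stirling numbers matches the removal of a point \<open>x\<close> from the domain: once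
  \<open>f x = c\<close> is chosen, the rest of \<open>f\<close> is onto \<open>C\<close> or onto \<open>C - {c}\<close>.\<close>

lemma card_surjections:
  assumes "finite A" "finite C"
  shows "card {f \<in> A \<rightarrow>\<^sub>E C. f ` A = C} = fact (card C) * Stirling (card A) (card C)"
  using assms
proof (induction A arbitrary: C rule: finite_induct)
  case (empty C)
  show ?case
  proof (cases "C = {}")
    case True
    then have "{f \<in> {} \<rightarrow>\<^sub>E C. f ` {} = C} = {\<lambda>x. undefined}" by auto
    then show ?thesis using True by simp
  next
    case False
    then obtain l where "card C = Suc l"
      using empty by (metis card_eq_0_iff not0_implies_Suc)
    then show ?thesis using False by auto
  qed
next
  case (insert x A)
  let ?S = "\<lambda>C. {f \<in> A \<rightarrow>\<^sub>E C. f ` A = C}"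
  let ?T = "\<lambda>c. ?S C \<union> ?S (C - {c})"
  have fin: "finite (?S D)" if "finite D" for D
    using insert.hyps that by (auto intro!: finite_subset[of _ "A \<rightarrow>\<^sub>E D"] finite_PiE)
  have inj: "inj_on (\<lambda>(c, f). f(x := c)) (Sigma C ?T)"
  proof (rule inj_onI, clarify)
    fix c f c' f'
    assume *: "f \<in> ?T c" "f' \<in> ?T c'" "f(x := c) = f'(x := c')"
    have "f x = undefined" using *(1) insert.hyps(2) by (elim UnE) (auto simp: PiE_def extensional_def)
    moreover have "f' x = undefined" using *(2) insert.hyps(2) by (elim UnE) (auto simp: PiE_def extensional_def)
    ultimately show "c = c' \<and> f = f'" using *(3) by (metis fun_upd_same fun_upd_triv fun_upd_upd)
  qed
  have "{f \<in> insert x A \<rightarrow>\<^sub>E C. f ` insert x A = C} = (\<lambda>(c, f). f(x := c)) ` Sigma C ?T"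
    (is "?L = ?R")
  proof
    show "?R \<subseteq> ?L"
    proof clarify
      fix c f assume c: "c \<in> C" and f: "f \<in> ?T c"
      have im: "f(x := c) ` insert x A = insert c (f ` A)" using insert.hyps(2) by auto
      moreover have "insert c (f ` A) = C" using c f by blast
      moreover have "f(x := c) \<in> extensional (insert x A)"
        using f by (auto simp: PiE_def extensional_def)
      ultimately show "f(x := c) \<in> insert x A \<rightarrow>\<^sub>E C \<and> f(x := c) ` insert x A = C"
        unfolding PiE_def by blast
    qed
    show "?L \<subseteq> ?R"
    proof
      fix f assume f: "f \<in> ?L"
      define h where "h = f(x := undefined)"
      have "h ` A = f ` A" unfolding h_def using insert.hyps(2) by auto
      moreover have "C = insert (f x) (f ` A)" using f by auto
      ultimately have "h ` A = C \<or> h ` A = C - {f x}"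
        by (metis Diff_insert_absorb insert_absorb)
      moreover have "h \<in> A \<rightarrow>\<^sub>E h ` A"
        unfolding h_def using f insert.hyps(2) by (auto simp: PiE_def extensional_def)
      ultimately have "h \<in> ?T (f x)" by (elim disjE) simp_all
      moreover have "f x \<in> C" using f by auto
      moreover have "f = h(x := f x)" by (simp add: h_def)
      ultimately show "f \<in> ?R" by (intro image_eqI[of _ _ "(f x, h)"]) auto
    qed
  qed
  then have "card ?L = card (Sigma C ?T)"
    using inj by (simp add: card_image)
  also have "\<dots> = (\<Sum>c\<in>C. card (?T c))"
    using insert.prems fin by (intro card_SigmaI) auto
  also have "\<dots> = (\<Sum>c\<in>C. card (?S C) + card (?S (C - {c})))"
    using insert.prems fin by (intro sum.cong refl card_Un_disjoint) auto
  also have "\<dots> = (\<Sum>c\<in>C. fact (card C) * Stirling (card A) (card C) +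
      fact (card C - 1) * Stirling (card A) (card C - 1))"
    using insert.prems by (intro sum.cong) (auto simp: insert.IH)
  also have "\<dots> = fact (card C) * Stirling (card (insert x A)) (card C)"
    using insert.hyps by (cases "card C") (simp_all add: algebra_simps)
  finally show ?case .
qed

text \<open>The combinatorial core of one factor of the count. A map \<open>\<phi>\<close> that covers \<open>U\<close> is determined by
  the set \<open>S\<close> of arguments that it sends into \<open>U\<close>, a surjection \<open>S \<rightarrow> U\<close>, and an arbitrary map of
  the other arguments into \<open>V\<close>; the index \<open>p\<close> is the cardinality of \<open>S\<close>.\<close>

lemma sum_covering_maps:
  fixes w :: "'b \<Rightarrow> nat"
  assumes A: "finite A" and U: "finite U" and V: "finite V" and UV: "U \<inter> V = {}"
    and w: "\<And>y. y \<in> U \<Longrightarrow> w y = c"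
  shows "(\<Sum>\<phi>\<in>A \<rightarrow>\<^sub>E U \<union> V. of_bool (U \<subseteq> \<phi> ` A) * (\<Prod>x\<in>A. w (\<phi> x))) =
    (\<Sum>p=card U..card A. (card A choose p) * fact (card U) * Stirling p (card U) * c ^ p *
       (\<Sum>y\<in>V. w y) ^ (card A - p))"
proof -
  let ?T = "U \<union> V"
  define h where "h S = fact (card U) * Stirling (card S) (card U) * c ^ card S *
       (\<Sum>y\<in>V. w y) ^ (card A - card S)" for S :: "'a set"
  \<comment> \<open>For \<open>\<phi>\<close> covering \<open>U\<close> exactly one \<open>S\<close> contributes, namely the preimage of \<open>U\<close>.\<close>
  have split: "of_bool (U \<subseteq> \<phi> ` A) =
      (\<Sum>S\<in>Pow A. of_bool (\<phi> ` S = U \<and> \<phi> ` (A - S) \<subseteq> V) :: nat)"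
    if \<phi>: "\<phi> \<in> A \<rightarrow>\<^sub>E ?T" for \<phi>
  proof -
    let ?S = "{x \<in> A. \<phi> x \<in> U}"
    have "S = ?S" if "S \<subseteq> A" "\<phi> ` S = U" "\<phi> ` (A - S) \<subseteq> V" for S
    proof (rule Set.set_eqI)
      fix x
      have "\<phi> x \<in> U" if "x \<in> S" using that \<open>\<phi> ` S = U\<close> by blast
      moreover have "\<phi> x \<notin> U" if "x \<in> A - S"
        using that \<open>\<phi> ` (A - S) \<subseteq> V\<close> UV by blast
      ultimately show "x \<in> S \<longleftrightarrow> x \<in> ?S" using \<open>S \<subseteq> A\<close> by blast
    qed
    moreover have "\<phi> ` (A - ?S) \<subseteq> V" using \<phi> by auto
    moreover have "\<phi> ` ?S = U \<longleftrightarrow> U \<subseteq> \<phi> ` A" by blast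
    ultimately have "{S \<in> Pow A. \<phi> ` S = U \<and> \<phi> ` (A - S) \<subseteq> V} = (if U \<subseteq> \<phi> ` A then {?S} else {})"
      by (cases "U \<subseteq> \<phi> ` A") (simp, blast)+
    then show ?thesis using A by (simp add: Int_def)
  qed
  have piece: "(\<Sum>\<phi>\<in>A \<rightarrow>\<^sub>E ?T. of_bool (\<phi> ` S = U \<and> \<phi> ` (A - S) \<subseteq> V) * (\<Prod>x\<in>A. w (\<phi> x))) = h S"
    if S: "S \<subseteq> A" for S
  proof -
    define part where "part b = (if b then S else A - S)" for b
    define g where "g b \<psi> = of_bool (if b then \<psi> ` part b = U else \<psi> ` part b \<subseteq> V) *
        (\<Prod>x\<in>part b. w (\<psi> x))" for b and \<psi> :: "'a \<Rightarrow> 'b"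
    have fS: "finite S" "finite (A - S)" using A S finite_subset by auto
    have UN: "(\<Union>b\<in>UNIV. part b) = A" using S by (auto simp: part_def UNIV_bool)
    have "(\<Sum>\<phi>\<in>A \<rightarrow>\<^sub>E ?T. of_bool (\<phi> ` S = U \<and> \<phi> ` (A - S) \<subseteq> V) * (\<Prod>x\<in>A. w (\<phi> x))) =
        (\<Sum>\<phi>\<in>A \<rightarrow>\<^sub>E ?T. \<Prod>b\<in>UNIV. g b (restrict \<phi> (part b)))"
      using prod.subset_diff[OF S A]
      by (intro sum.cong) (auto simp: UNIV_bool g_def part_def)
    also have "\<dots> = (\<Prod>b\<in>UNIV. \<Sum>\<psi>\<in>part b \<rightarrow>\<^sub>E ?T. g b \<psi>)"
      by (rule sum_prod_PiE_UN[where A = part and I = UNIV, unfolded UN])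
        (use fS U V in \<open>auto simp: part_def disjoint_family_on_def\<close>)
    also have "\<dots> = (\<Sum>\<psi>\<in>S \<rightarrow>\<^sub>E ?T. g True \<psi>) * (\<Sum>\<psi>\<in>A - S \<rightarrow>\<^sub>E ?T. g False \<psi>)"
      by (simp add: UNIV_bool part_def mult.commute)
    also have "(\<Sum>\<psi>\<in>S \<rightarrow>\<^sub>E ?T. g True \<psi>) = (\<Sum>\<psi>\<in>{f \<in> S \<rightarrow>\<^sub>E U. f ` S = U}. c ^ card S)"
    proof (rule sum.mono_neutral_cong_right)
      show "finite (S \<rightarrow>\<^sub>E ?T)" using fS U V by (auto intro: finite_PiE)
      show "{f \<in> S \<rightarrow>\<^sub>E U. f ` S = U} \<subseteq> S \<rightarrow>\<^sub>E ?T" by auto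
      show "\<forall>\<psi>\<in>(S \<rightarrow>\<^sub>E ?T) - {f \<in> S \<rightarrow>\<^sub>E U. f ` S = U}. g True \<psi> = 0"
        by (auto simp: g_def part_def PiE_def)
      show "g True \<psi> = c ^ card S" if "\<psi> \<in> {f \<in> S \<rightarrow>\<^sub>E U. f ` S = U}" for \<psi>
      proof -
        have "(\<Prod>x\<in>S. w (\<psi> x)) = (\<Prod>x\<in>S. c)" using that w by (intro prod.cong) auto
        then show ?thesis using that by (simp add: g_def part_def)
      qed
    qed
    also have "\<dots> = fact (card U) * Stirling (card S) (card U) * c ^ card S"
      by (simp add: card_surjections[OF fS(1) U])
    also have "(\<Sum>\<psi>\<in>A - S \<rightarrow>\<^sub>E ?T. g False \<psi>) = (\<Sum>\<psi>\<in>A - S \<rightarrow>\<^sub>E V. \<Prod>x\<in>A - S. w (\<psi> x))"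
    proof (rule sum.mono_neutral_cong_right)
      show "finite (A - S \<rightarrow>\<^sub>E ?T)" using fS U V by (auto intro: finite_PiE)
      show "A - S \<rightarrow>\<^sub>E V \<subseteq> A - S \<rightarrow>\<^sub>E ?T" by auto
      show "\<forall>\<psi>\<in>(A - S \<rightarrow>\<^sub>E ?T) - (A - S \<rightarrow>\<^sub>E V). g False \<psi> = 0"
        by (auto simp: g_def part_def PiE_def)
      show "g False \<psi> = (\<Prod>x\<in>A - S. w (\<psi> x))" if "\<psi> \<in> A - S \<rightarrow>\<^sub>E V" for \<psi>
        using that by (auto simp: g_def part_def)
    qed
    also have "\<dots> = (\<Prod>x\<in>A - S. \<Sum>y\<in>V. w y)"
      using prod_sum_PiE[of "A - S" "\<lambda>_. V" "\<lambda>_. w"] fS V by simp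
    also have "\<dots> = (\<Sum>y\<in>V. w y) ^ (card A - card S)"
      using S fS by (simp add: card_Diff_subset)
    finally show ?thesis by (simp add: h_def)
  qed
  have "(\<Sum>\<phi>\<in>A \<rightarrow>\<^sub>E ?T. of_bool (U \<subseteq> \<phi> ` A) * (\<Prod>x\<in>A. w (\<phi> x))) =
      (\<Sum>\<phi>\<in>A \<rightarrow>\<^sub>E ?T. \<Sum>S\<in>Pow A. of_bool (\<phi> ` S = U \<and> \<phi> ` (A - S) \<subseteq> V) * (\<Prod>x\<in>A. w (\<phi> x)))"
    by (intro sum.cong refl) (simp only: split sum_distrib_right)
  also have "\<dots> = (\<Sum>S\<in>Pow A. h S)"
    by (subst sum.swap) (simp add: piece)
  also have "\<dots> = (\<Sum>p=0..card A. \<Sum>S | S \<in> Pow A \<and> card S = p. h S)"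
    using A by (intro sum.group[symmetric]) (auto simp: card_mono)
  also have "\<dots> = (\<Sum>p=0..card A. (card A choose p) * (fact (card U) * Stirling p (card U) * c ^ p *
       (\<Sum>y\<in>V. w y) ^ (card A - p)))"
    by (intro sum.cong) (auto simp: h_def n_subsets[OF A])
  also have "\<dots> = (\<Sum>p=card U..card A. (card A choose p) * (fact (card U) * Stirling p (card U) * c ^ p *
       (\<Sum>y\<in>V. w y) ^ (card A - p)))"
    by (rule sum.mono_neutral_right) auto
  finally show ?thesis by (simp add: mult.assoc)
qed


section \<open>Regular elements\<close>

text \<open>The cardinality condition is what makes \<open>f\<close> invertible on a suitable block over each image
  block. Finiteness of \<open>X\<close> enters here: a surjection between finite blocks of equal cardinality is
  a bijection.\<close>

lemma Reg_Gamma_eq: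
  assumes X: "finite X" and P: "partition_on X P"
  shows "Reg (Gamma X P) =
    {f \<in> X \<rightarrow>\<^sub>E X. (\<forall>B\<in>P. f ` B \<in> P) \<and>
      (\<forall>B\<in>P. \<exists>B'\<in>P. card B' = card (f ` B) \<and> f ` B' = f ` B)}"
proof (intro equalityI subsetI)
  have sub: "B \<subseteq> X" if "B \<in> P" for B
    using P that by (auto simp: partition_on_def)
  have finB: "finite B" if "B \<in> P" for B
    using sub[OF that] X finite_subset by blast
  {
    fix f assume "f \<in> Reg (Gamma X P)"
    then obtain b where f: "f \<in> X \<rightarrow>\<^sub>E X" "\<forall>B\<in>P. f ` B \<in> P"
      and b: "\<forall>B\<in>P. b ` B \<in> P" and eq: "f = compose X f (compose X b f)"
      unfolding Reg_def Gamma_def by auto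
    have fbf: "f (b (f x)) = f x" if "x \<in> X" for x
      using fun_cong[OF eq, of x] that by (simp add: compose_def)
    have "\<exists>B'\<in>P. card B' = card (f ` B) \<and> f ` B' = f ` B" if B: "B \<in> P" for B
    proof (intro bexI conjI)
      show B': "b ` f ` B \<in> P" using f b B by blast
      show img: "f ` b ` f ` B = f ` B"
        using fbf sub[OF B] by (force simp: image_image)
      show "card (b ` f ` B) = card (f ` B)"
        using card_image_le[of "f ` B" b] card_image_le[OF finB[OF B'], of f] finB[OF B]
        by (simp add: img)
    qed
    then show "f \<in> {f \<in> X \<rightarrow>\<^sub>E X. (\<forall>B\<in>P. f ` B \<in> P) \<and>
        (\<forall>B\<in>P. \<exists>B'\<in>P. card B' = card (f ` B) \<and> f ` B' = f ` B)}"
      using f by blast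
  next
    fix f assume "f \<in> {f \<in> X \<rightarrow>\<^sub>E X. (\<forall>B\<in>P. f ` B \<in> P) \<and>
        (\<forall>B\<in>P. \<exists>B'\<in>P. card B' = card (f ` B) \<and> f ` B' = f ` B)}"
    then have f: "f \<in> X \<rightarrow>\<^sub>E X" "\<And>B. B \<in> P \<Longrightarrow> f ` B \<in> P"
      and ex: "\<And>B. B \<in> P \<Longrightarrow> \<exists>B'\<in>P. card B' = card (f ` B) \<and> f ` B' = f ` B"
      by auto
    define \<Q> where "\<Q> = (\<lambda>B. f ` B) ` P"
    have "\<forall>C\<in>\<Q>. \<exists>B'. B' \<in> P \<and> card B' = card C \<and> f ` B' = C"
      using ex unfolding \<Q>_def by blast
    then obtain s where s: "\<And>C. C \<in> \<Q> \<Longrightarrow> s C \<in> P \<and> card (s C) = card C \<and> f ` s C = C"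
      by metis
    have bij: "bij_betw f (s C) C" if "C \<in> \<Q>" for C
      using s[OF that] finB eq_card_imp_inj_on[of "s C" f] by (auto simp: bij_betw_def)
    define block where "block y = (THE B. B \<in> P \<and> y \<in> B)" for y
    have block: "block y = B" if "B \<in> P" "y \<in> B" for y B
      unfolding block_def using P that
      by (intro the_equality) (auto simp: partition_on_def disjoint_def)
    \<comment> \<open>Off the image blocks any block-preserving choice of \<open>b\<close> will do; the identity is one.\<close>
    define b where
      "b = (\<lambda>y\<in>X. if block y \<in> \<Q> then inv_into (s (block y)) f y else y)"
    have b_image: "b ` B = (if B \<in> \<Q> then s B else B)" if B: "B \<in> P" for B
    proof -
      have "b ` B = (\<lambda>y. if B \<in> \<Q> then inv_into (s B) f y else y) ` B"
        using sub[OF B] block[OF B] by (intro image_cong) (auto simp: b_def)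
      also have "\<dots> = (if B \<in> \<Q> then s B else B)"
        using bij_betw_imp_surj_on[OF bij_betw_inv_into[OF bij[of B]]] by auto
      finally show ?thesis .
    qed
    have bP: "b ` B \<in> P" if "B \<in> P" for B
      using b_image[OF that] s that by auto
    have "b \<in> X \<rightarrow> X"
    proof
      fix y assume "y \<in> X"
      then obtain B where "B \<in> P" "y \<in> B" using P by (auto simp: partition_on_def)
      then show "b y \<in> X" using bP[of B] sub by blast
    qed
    moreover have "b \<in> extensional X" by (simp add: b_def)
    ultimately have b: "b \<in> X \<rightarrow>\<^sub>E X" by (simp add: PiE_def)
    have fbf: "f (b (f x)) = f x" if x: "x \<in> X" for x
    proof -
      obtain B where B: "B \<in> P" "x \<in> B" using P x by (auto simp: partition_on_def)
      have C: "f ` B \<in> \<Q>" "f x \<in> f ` B" using B by (auto simp: \<Q>_def)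
      have "block (f x) = f ` B" using block f(2)[OF B(1)] C(2) by blast
      moreover have "f x \<in> X" using f(1) x by blast
      ultimately have "b (f x) = inv_into (s (f ` B)) f (f x)" using C(1) by (simp add: b_def)
      moreover have "f x \<in> f ` s (f ` B)" using s[OF C(1)] C(2) by blast
      ultimately show ?thesis by (simp add: f_inv_into_f)
    qed
    have "f = compose X f (compose X b f)"
    proof
      fix x show "f x = compose X f (compose X b f) x"
        using fbf[of x] PiE_arb[OF f(1), of x] by (cases "x \<in> X") (simp_all add: compose_def)
    qed
    then show "f \<in> Reg (Gamma X P)"
      using f b bP by (auto simp: Reg_def Gamma_def)
  }
qed

section \<open>Block maps\<close>

text \<open>The maps that the regular elements with set of image blocks \<open>Q\<close> induce on \<open>P\<close>. Surjectivity
  onto \<open>Q\<close> is part of the covering condition.\<close>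

definition block_maps :: "'a set set \<Rightarrow> 'a set set \<Rightarrow> ('a set \<Rightarrow> 'a set) set" where
  "block_maps P Q = {\<phi> \<in> P \<rightarrow>\<^sub>E Q. \<forall>C\<in>Q. \<exists>B\<in>P. card B = card C \<and> \<phi> B = C}"

lemma card_maps_inducing_block_map:
  assumes X: "finite X" and P: "partition_on X P" and \<phi>: "\<And>B. B \<in> P \<Longrightarrow> \<phi> B \<in> P"
  shows "card {f \<in> X \<rightarrow>\<^sub>E X. \<forall>B\<in>P. f ` B = \<phi> B} =
    (\<Prod>B\<in>P. fact (card (\<phi> B)) * Stirling (card B) (card (\<phi> B)))"
proof -
  have sub: "B \<subseteq> X" if "B \<in> P" for B
    using P that by (auto simp: partition_on_def)
  have finB: "finite B" if "B \<in> P" for B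
    using sub[OF that] X finite_subset by blast
  have UN: "(\<Union>B\<in>P. B) = X" and disj: "disjoint_family_on (\<lambda>B. B) P"
    using P by (auto simp: partition_on_def disjoint_family_on_def disjoint_def)
  have "card {f \<in> X \<rightarrow>\<^sub>E X. \<forall>B\<in>P. f ` B = \<phi> B} =
      (\<Prod>B\<in>P. card {h \<in> B \<rightarrow>\<^sub>E X. h ` B = \<phi> B})"
    using card_PiE_UN[OF finite_elements[OF X P] finB disj X, where R = "\<lambda>B h. h ` B = \<phi> B"]
    by (simp add: UN[simplified])
  also have "\<dots> = (\<Prod>B\<in>P. card {h \<in> B \<rightarrow>\<^sub>E \<phi> B. h ` B = \<phi> B})"
  proof (intro prod.cong refl arg_cong[where f = card])
    fix B assume "B \<in> P"
    then have "\<phi> B \<subseteq> X" using \<phi> sub by blast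
    then show "{h \<in> B \<rightarrow>\<^sub>E X. h ` B = \<phi> B} = {h \<in> B \<rightarrow>\<^sub>E \<phi> B. h ` B = \<phi> B}"
      by (auto simp: PiE_def)
  qed
  also have "\<dots> = (\<Prod>B\<in>P. fact (card (\<phi> B)) * Stirling (card B) (card (\<phi> B)))"
    using \<phi> finB by (intro prod.cong refl card_surjections) auto
  finally show ?thesis .
qed

text \<open>A regular element determines its block map, and the block map determines \<open>Q\<close> as its image, so
  the regular elements fall into disjoint classes indexed by the pairs \<open>(Q, \<phi>)\<close>.\<close>

lemma card_Reg_Gamma:
  assumes X: "finite X" and P: "partition_on X P"
  shows "card (Reg (Gamma X P)) = (\<Sum>Q\<in>Pow P. \<Sum>\<phi>\<in>block_maps P Q.
    \<Prod>B\<in>P. fact (card (\<phi> B)) * Stirling (card B) (card (\<phi> B)))"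
proof -
  let ?M = "\<lambda>(Q, \<phi>). {f \<in> X \<rightarrow>\<^sub>E X. \<forall>B\<in>P. f ` B = \<phi> B}"
  let ?I = "Sigma (Pow P) (block_maps P)"
  have finP: "finite P" by (rule finite_elements[OF X P])
  have finR: "finite (block_maps P Q)" if "Q \<in> Pow P" for Q
    unfolding block_maps_def using that finP finite_subset
    by (intro finite_subset[OF _ finite_PiE[of P "\<lambda>_. Q"]]) auto
  have image: "\<phi> ` P = Q" if "\<phi> \<in> block_maps P Q" for \<phi> Q
    using that by (auto simp: block_maps_def)
  have "Reg (Gamma X P) = (\<Union>u\<in>?I. ?M u)"
  proof (intro equalityI subsetI)
    fix f assume "f \<in> Reg (Gamma X P)"
    then have f: "f \<in> X \<rightarrow>\<^sub>E X" "\<And>B. B \<in> P \<Longrightarrow> f ` B \<in> P"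
      and ex: "\<And>B. B \<in> P \<Longrightarrow> \<exists>B'\<in>P. card B' = card (f ` B) \<and> f ` B' = f ` B"
      unfolding Reg_Gamma_eq[OF assms] by auto
    have "(\<lambda>B\<in>P. f ` B) \<in> block_maps P ((\<lambda>B. f ` B) ` P)"
      unfolding block_maps_def using ex by fastforce
    then have "((\<lambda>B. f ` B) ` P, \<lambda>B\<in>P. f ` B) \<in> ?I" using f(2) by blast
    moreover have "f \<in> ?M ((\<lambda>B. f ` B) ` P, \<lambda>B\<in>P. f ` B)" using f(1) by simp
    ultimately show "f \<in> (\<Union>u\<in>?I. ?M u)" by (rule UN_I)
  next
    fix f assume "f \<in> (\<Union>u\<in>?I. ?M u)"
    then obtain u where u: "u \<in> ?I" "f \<in> ?M u" by (elim UN_E)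
    obtain Q \<phi> where "u = (Q, \<phi>)" by (cases u)
    then have Q: "Q \<subseteq> P" "\<phi> \<in> block_maps P Q"
      and f: "f \<in> X \<rightarrow>\<^sub>E X" "\<And>B. B \<in> P \<Longrightarrow> f ` B = \<phi> B"
      using u by simp_all
    have "\<exists>B'\<in>P. card B' = card (f ` B) \<and> f ` B' = f ` B" if "B \<in> P" for B
    proof -
      have "\<phi> B \<in> Q" using Q(2) that by (auto simp: block_maps_def)
      then obtain B' where "B' \<in> P" "card B' = card (\<phi> B)" "\<phi> B' = \<phi> B"
        using Q(2) by (auto simp: block_maps_def)
      then show ?thesis using f(2) that by metis
    qed
    moreover have "f ` B \<in> P" if "B \<in> P" for B
      using image[OF Q(2)] Q(1) f(2) that by auto
    ultimately show "f \<in> Reg (Gamma X P)"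
      unfolding Reg_Gamma_eq[OF assms] using f(1) by simp
  qed
  moreover have "disjoint_family_on ?M ?I"
  proof -
    have unique: "Q = Q' \<and> \<phi> = \<phi>'" if "\<phi> \<in> block_maps P Q" "\<phi>' \<in> block_maps P Q'"
      "\<And>B. B \<in> P \<Longrightarrow> f ` B = \<phi> B" "\<And>B. B \<in> P \<Longrightarrow> f ` B = \<phi>' B"
      for Q Q' \<phi> \<phi>' and f :: "'a \<Rightarrow> 'a"
    proof -
      have "\<phi> \<in> extensional P" "\<phi>' \<in> extensional P"
        using that(1,2) by (auto simp: block_maps_def PiE_def)
      then have "\<phi> = \<phi>'" using that(3,4) by (metis extensionalityI)
      then show ?thesis using image that(1,2) by blast
    qed
    have "u = v" if "u \<in> ?I" "v \<in> ?I" "f \<in> ?M u" "f \<in> ?M v" for u v f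
    proof -
      obtain Q \<phi> Q' \<phi>' where "u = (Q, \<phi>)" "v = (Q', \<phi>')" by (cases u, cases v)
      then show ?thesis using unique[of \<phi> Q \<phi>' Q' f] that by simp
    qed
    then show ?thesis unfolding disjoint_family_on_def by (meson disjoint_iff)
  qed
  moreover have "finite ?I" using finP finR by (intro finite_SigmaI) auto
  moreover have "finite (?M u)" for u
    using X by (cases u) (auto intro!: finite_subset[OF _ finite_PiE[of X "\<lambda>_. X"]])
  ultimately have "card (Reg (Gamma X P)) = (\<Sum>u\<in>?I. card (?M u))"
    by (simp only:) (intro card_UN_disjoint', auto)
  also have "\<dots> = (\<Sum>(Q, \<phi>)\<in>?I. \<Prod>B\<in>P. fact (card (\<phi> B)) * Stirling (card B) (card (\<phi> B)))"
    using image by (intro sum.cong) (auto intro!: card_maps_inducing_block_map[OF assms])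
  also have "\<dots> = (\<Sum>Q\<in>Pow P. \<Sum>\<phi>\<in>block_maps P Q.
      \<Prod>B\<in>P. fact (card (\<phi> B)) * Stirling (card B) (card (\<phi> B)))"
    using finP finR by (intro sum.Sigma[symmetric]) auto
  finally show ?thesis .
qed

section \<open>Factorization over the block sizes\<close>

lemma disjoint_family_blocks_of_size:
  assumes "inj_on n I"
  shows "disjoint_family_on (\<lambda>i. blocks_of_size R (n i)) I"
  unfolding disjoint_family_on_def
proof (intro ballI impI equals0I)
  fix i j B assume "i \<in> I" "j \<in> I" "i \<noteq> j" "B \<in> blocks_of_size R (n i) \<inter> blocks_of_size R (n j)"
  then have "n i = n j" by (simp add: blocks_of_size_def)
  then show False using assms \<open>i \<in> I\<close> \<open>j \<in> I\<close> \<open>i \<noteq> j\<close> by (meson inj_onD)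
qed

text \<open>The condition that defines block maps relates only blocks of equal size, so it splits into
  one covering condition for each size. Within a size the weight of \<open>\<phi> B\<close> no longer depends on
  \<open>B\<close>, so \<open>sum_covering_maps\<close> applies, with \<open>U\<close> the blocks of \<open>Q\<close> of that size and \<open>V\<close> the other
  blocks of \<open>Q\<close>.\<close>

lemma sum_block_maps:
  fixes n :: "nat \<Rightarrow> nat"
  assumes finP: "finite P" and QP: "Q \<subseteq> P" and n: "strict_mono_on {1..k} n"
    and P: "P = (\<Union>i\<in>{1..k}. blocks_of_size P (n i))"
  defines "ms \<equiv> \<lambda>i. card (blocks_of_size P (n i))"
    and "rt \<equiv> \<lambda>i. card (blocks_of_size Q (n i))"
  shows "(\<Sum>\<phi>\<in>block_maps P Q. \<Prod>B\<in>P. fact (card (\<phi> B)) * Stirling (card B) (card (\<phi> B))) =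
    (\<Prod>i=1..k. \<Sum>p=rt i..ms i.
       (ms i choose p) * fact (rt i) * Stirling p (rt i) * fact (n i) ^ p *
       (\<Sum>j=1..i-1. rt j * fact (n j) * Stirling (n i) (n j)) ^ (ms i - p))"
proof -
  let ?I = "{1..k}"
  let ?P = "\<lambda>i. blocks_of_size P (n i)" and ?Q = "\<lambda>i. blocks_of_size Q (n i)"
  define w where "w i C = fact (card C) * Stirling (n i) (card C)" for i and C :: "'a set"
  define g where "g i \<psi> = of_bool (?Q i \<subseteq> \<psi> ` ?P i) * (\<Prod>B\<in>?P i. w i (\<psi> B))"
    for i and \<psi> :: "'a set \<Rightarrow> 'a set"
  have finQ: "finite Q" using finP QP finite_subset by blast
  have disj: "disjoint_family_on (\<lambda>i. blocks_of_size R (n i)) ?I" for R :: "'a set set"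
    by (rule disjoint_family_blocks_of_size[OF strict_mono_on_imp_inj_on[OF n]])
  have finPi: "finite (?P i)" and finQi: "finite (?Q i)" for i
    using finP finQ by (auto simp: blocks_of_size_def)
  have sizes: "\<exists>i\<in>?I. card C = n i" if "C \<in> P" for C
    using P that by (auto simp: blocks_of_size_def)
  have cover: "(\<forall>C\<in>Q. \<exists>B\<in>P. card B = card C \<and> \<phi> B = C) \<longleftrightarrow> (\<forall>i\<in>?I. ?Q i \<subseteq> \<phi> ` ?P i)" for \<phi>
  proof
    assume *: "\<forall>C\<in>Q. \<exists>B\<in>P. card B = card C \<and> \<phi> B = C"
    show "\<forall>i\<in>?I. ?Q i \<subseteq> \<phi> ` ?P i"
    proof (intro ballI subsetI)
      fix i C assume C: "C \<in> ?Q i"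
      then obtain B where "B \<in> P" "card B = card C" "\<phi> B = C"
        using * by (auto simp: blocks_of_size_def)
      then show "C \<in> \<phi> ` ?P i" using C by (auto simp: blocks_of_size_def)
    qed
  next
    assume *: "\<forall>i\<in>?I. ?Q i \<subseteq> \<phi> ` ?P i"
    show "\<forall>C\<in>Q. \<exists>B\<in>P. card B = card C \<and> \<phi> B = C"
    proof
      fix C assume C: "C \<in> Q"
      then obtain i where i: "i \<in> ?I" "card C = n i" using sizes QP by blast
      then have "C \<in> \<phi> ` ?P i" using * C by (auto simp: blocks_of_size_def)
      then show "\<exists>B\<in>P. card B = card C \<and> \<phi> B = C"
        using i by (auto simp: blocks_of_size_def)
    qed
  qed
  have "(\<Sum>\<phi>\<in>block_maps P Q. \<Prod>B\<in>P. fact (card (\<phi> B)) * Stirling (card B) (card (\<phi> B))) =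
      (\<Sum>\<phi>\<in>P \<rightarrow>\<^sub>E Q. of_bool (\<forall>i\<in>?I. ?Q i \<subseteq> \<phi> ` ?P i) *
        (\<Prod>B\<in>P. fact (card (\<phi> B)) * Stirling (card B) (card (\<phi> B))))"
    using finP finQ
    by (intro sum.mono_neutral_cong_left) (auto simp: block_maps_def cover intro: finite_PiE)
  also have "\<dots> = (\<Sum>\<phi>\<in>P \<rightarrow>\<^sub>E Q. \<Prod>i\<in>?I. g i (restrict \<phi> (?P i)))"
  proof (intro sum.cong refl)
    fix \<phi> :: "'a set \<Rightarrow> 'a set"
    have "(\<Prod>B\<in>P. fact (card (\<phi> B)) * Stirling (card B) (card (\<phi> B))) =
        (\<Prod>i\<in>?I. \<Prod>B\<in>?P i. fact (card (\<phi> B)) * Stirling (card B) (card (\<phi> B)))"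
      by (subst P, rule prod.UNION_disjoint) (use finPi disj in \<open>auto simp: disjoint_family_on_def\<close>)
    also have "\<dots> = (\<Prod>i\<in>?I. \<Prod>B\<in>?P i. w i (\<phi> B))"
      by (intro prod.cong) (auto simp: w_def blocks_of_size_def)
    finally show "of_bool (\<forall>i\<in>?I. ?Q i \<subseteq> \<phi> ` ?P i) *
        (\<Prod>B\<in>P. fact (card (\<phi> B)) * Stirling (card B) (card (\<phi> B))) =
        (\<Prod>i\<in>?I. g i (restrict \<phi> (?P i)))"
      by (simp add: g_def prod.distrib prod_of_bool)
  qed
  also have "\<dots> = (\<Prod>i\<in>?I. \<Sum>\<psi>\<in>?P i \<rightarrow>\<^sub>E Q. g i \<psi>)"
    using sum_prod_PiE_UN[of ?I ?P Q g, folded P] disj finPi finQ by simp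
  also have "\<dots> = (\<Prod>i\<in>?I. \<Sum>p=rt i..ms i.
       (ms i choose p) * fact (rt i) * Stirling p (rt i) * fact (n i) ^ p *
       (\<Sum>j=1..i-1. rt j * fact (n j) * Stirling (n i) (n j)) ^ (ms i - p))"
  proof (intro prod.cong refl)
    fix i assume i: "i \<in> ?I"
    let ?V = "Q - ?Q i"
    have Q: "?Q i \<union> ?V = Q" by (auto simp: blocks_of_size_def)
    have lt: "n j < n i" if "j \<in> {1..i-1}" for j
      using i that by (intro strict_mono_onD[OF n]) auto
    \<comment> \<open>Blocks larger than \<open>n i\<close> have weight 0, since \<open>Stirling a b = 0\<close> for \<open>a < b\<close>.\<close>
    have "(\<Sum>C\<in>?V. w i C) = (\<Sum>C\<in>(\<Union>j\<in>{1..i-1}. ?Q j). w i C)"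
    proof (rule sum.mono_neutral_right)
      show "finite ?V" using finQ by simp
      show "(\<Union>j\<in>{1..i-1}. ?Q j) \<subseteq> ?V" using lt by (fastforce simp: blocks_of_size_def)
      show "\<forall>C\<in>?V - (\<Union>j\<in>{1..i-1}. ?Q j). w i C = 0"
      proof
        fix C assume C: "C \<in> ?V - (\<Union>j\<in>{1..i-1}. ?Q j)"
        then obtain j where j: "j \<in> ?I" "card C = n j" using sizes QP by blast
        then have "\<not> j \<le> i - 1" "j \<noteq> i" using C by (auto simp: blocks_of_size_def)
        then have "n i < n j" using i j by (intro strict_mono_onD[OF n]) auto
        then show "w i C = 0" by (simp add: w_def j)
      qed
    qed
    also have "\<dots> = (\<Sum>j=1..i-1. \<Sum>C\<in>?Q j. w i C)"
    proof (rule sum.UNION_disjoint)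
      have "disjoint_family_on ?Q {1..i-1}"
        using i by (intro disjoint_family_on_mono[OF _ disj]) auto
      then show "\<forall>j\<in>{1..i-1}. \<forall>j'\<in>{1..i-1}. j \<noteq> j' \<longrightarrow> ?Q j \<inter> ?Q j' = {}"
        unfolding disjoint_family_on_def .
    qed (use finQi in auto)
    also have "\<dots> = (\<Sum>j=1..i-1. rt j * fact (n j) * Stirling (n i) (n j))"
    proof (rule sum.cong[OF refl])
      fix j
      have "(\<Sum>C\<in>?Q j. w i C) = (\<Sum>C\<in>?Q j. fact (n j) * Stirling (n i) (n j))"
        by (intro sum.cong) (auto simp: w_def blocks_of_size_def)
      then show "(\<Sum>C\<in>?Q j. w i C) = rt j * fact (n j) * Stirling (n i) (n j)"
        by (simp add: rt_def)
    qed
    finally have V: "(\<Sum>C\<in>?V. w i C) = (\<Sum>j=1..i-1. rt j * fact (n j) * Stirling (n i) (n j))" .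
    have "(\<Sum>\<psi>\<in>?P i \<rightarrow>\<^sub>E ?Q i \<union> ?V. g i \<psi>) = (\<Sum>p=rt i..ms i.
       (ms i choose p) * fact (rt i) * Stirling p (rt i) * fact (n i) ^ p *
       (\<Sum>C\<in>?V. w i C) ^ (ms i - p))"
      unfolding g_def rt_def ms_def using finPi finQi finQ
      by (intro sum_covering_maps) (auto simp: w_def blocks_of_size_def)
    then show "(\<Sum>\<psi>\<in>?P i \<rightarrow>\<^sub>E Q. g i \<psi>) = (\<Sum>p=rt i..ms i.
       (ms i choose p) * fact (rt i) * Stirling p (rt i) * fact (n i) ^ p *
       (\<Sum>j=1..i-1. rt j * fact (n j) * Stirling (n i) (n j)) ^ (ms i - p))"
      by (simp only: V Q)
  qed
  finally show ?thesis .
qed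

theorem theorem6p10:
  fixes X :: "'a set" and P :: "'a set set"
    and m k :: nat and ms n :: "nat \<Rightarrow> nat"
  assumes "finite X" and "card X \<ge> 3"
    and "mk_partition m k X P"
    and "strict_mono_on {1..k} n"
    and "\<And>i. i \<in> {1..k} \<Longrightarrow> card (blocks_of_size P (n i)) = ms i"
    and "m = (\<Sum>i=1..k. ms i)"
  shows "card (Reg (Gamma X P)) =
    (\<Sum>r=1..m. \<Sum>Q | Q \<in> subpartitions r P \<and> blocks_of_size Q (n 1) \<noteq> {}.
      let rt = (\<lambda>i. card (blocks_of_size Q (n i))) in
        fact (rt 1) * Stirling (ms 1) (rt 1) * fact (n 1) ^ ms 1 *
        (\<Prod>i=2..k. \<Sum>p=rt i..ms i.
           (ms i choose p) * fact (rt i) * Stirling p (rt i) * fact (n i) ^ p *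
           (\<Sum>j=1..i-1. rt j * fact (n j) * Stirling (n i) (n j)) ^ (ms i - p)))"
proof -
  let ?P = "\<lambda>i. blocks_of_size P (n i)" and ?Q = "\<lambda>Q i. card (blocks_of_size Q (n i))"
  define F :: "'a set set \<Rightarrow> nat" where "F Q = fact (?Q Q 1) * Stirling (ms 1) (?Q Q 1) * fact (n 1) ^ ms 1 *
        (\<Prod>i=2..k. \<Sum>p=?Q Q i..ms i.
           (ms i choose p) * fact (?Q Q i) * Stirling p (?Q Q i) * fact (n i) ^ p *
           (\<Sum>j=1..i-1. ?Q Q j * fact (n j) * Stirling (n i) (n j)) ^ (ms i - p))" for Q
  have k: "0 < k" and part: "partition_on X P" and cardP: "card P = m"
    and cardk: "card (card ` P) = k"
    using assms(3) by (auto simp: mk_partition_def)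
  have finP: "finite P" by (rule finite_elements[OF assms(1) part])
  have inj: "inj_on n {1..k}" by (rule strict_mono_on_imp_inj_on[OF assms(4)])
  have fin: "finite (blocks_of_size R s)" if "R \<subseteq> P" for R s
    using finite_subset[OF that finP] by (auto simp: blocks_of_size_def)
  \<comment> \<open>The numbers \<open>ms i\<close> add up to the number of blocks, so no block has a size outside the list.\<close>
  have P: "P = (\<Union>i\<in>{1..k}. ?P i)"
  proof -
    have "card (\<Union>i\<in>{1..k}. ?P i) = (\<Sum>i=1..k. card (?P i))"
      using fin by (intro card_UN_disjoint' disjoint_family_blocks_of_size[OF inj]) auto
    also have "\<dots> = card P" using assms(5,6) cardP by simp
    finally show ?thesis
      using finP by (intro card_subset_eq[symmetric]) (auto simp: blocks_of_size_def)
  qed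
  \<comment> \<open>There are \<open>k\<close> distinct block sizes among the \<open>k\<close> values of \<open>n\<close>, so each value occurs.\<close>
  have "ms 1 \<noteq> 0"
  proof -
    have "card ` P \<subseteq> n ` {1..k}"
      by (subst P) (auto simp: blocks_of_size_def)
    then have "card ` P = n ` {1..k}"
      using cardk inj by (intro card_subset_eq) (simp_all add: card_image)
    then have "n 1 \<in> card ` P" using k by auto
    then have "?P 1 \<noteq> {}" by (auto simp: blocks_of_size_def)
    then show ?thesis using assms(5)[of 1] k fin[of P] by (auto simp: card_eq_0_iff)
  qed
  have count: "(\<Sum>\<phi>\<in>block_maps P Q. \<Prod>B\<in>P. fact (card (\<phi> B)) * Stirling (card B) (card (\<phi> B)))
      = F Q" if Q: "Q \<subseteq> P" for Q
  proof -
    define G where "G i = (\<Sum>p=?Q Q i..ms i.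
           (ms i choose p) * fact (?Q Q i) * Stirling p (?Q Q i) * fact (n i) ^ p *
           (\<Sum>j=1..i-1. ?Q Q j * fact (n j) * Stirling (n i) (n j)) ^ (ms i - p))" for i
    have "(\<Sum>\<phi>\<in>block_maps P Q. \<Prod>B\<in>P. fact (card (\<phi> B)) * Stirling (card B) (card (\<phi> B)))
        = (\<Prod>i=1..k. G i)"
      unfolding sum_block_maps[OF finP Q assms(4) P] G_def
      using assms(5) by (intro prod.cong) simp_all
    also have "\<dots> = G 1 * (\<Prod>i=2..k. G i)"
      using k prod.atLeast_Suc_atMost[of 1 k G] by (simp add: numeral_2_eq_2)
    also have "G 1 = fact (?Q Q 1) * Stirling (ms 1) (?Q Q 1) * fact (n 1) ^ ms 1"
    proof -
      have "?Q Q 1 \<le> card (?P 1)"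
        using fin[of P] Q by (intro card_mono) (auto simp: blocks_of_size_def)
      then have "?Q Q 1 \<le> ms 1" using assms(5)[of 1] k by simp
      \<comment> \<open>The inner sum over \<open>j < 1\<close> is empty, and \<open>0 ^ (ms 1 - p)\<close> vanishes unless \<open>p = ms 1\<close>.\<close>
      then have "G 1 = (\<Sum>p\<in>{ms 1}. (ms 1 choose p) * fact (?Q Q 1) *
          Stirling p (?Q Q 1) * fact (n 1) ^ p * 0 ^ (ms 1 - p))"
        unfolding G_def by (intro sum.mono_neutral_cong_right) auto
      then show ?thesis by simp
    qed
    finally show ?thesis by (simp add: F_def G_def)
  qed
  let ?\<F> = "{Q \<in> Pow P. blocks_of_size Q (n 1) \<noteq> {}}"
  have "card (Reg (Gamma X P)) = (\<Sum>Q\<in>Pow P. F Q)"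
    unfolding card_Reg_Gamma[OF assms(1) part] by (intro sum.cong) (auto simp: count)
  also have "\<dots> = (\<Sum>Q\<in>?\<F>. F Q)"
  proof (rule sum.mono_neutral_right)
    \<comment> \<open>Without a block of the smallest size in \<open>Q\<close> the first factor is a multiple of
      \<open>Stirling (ms 1) 0\<close>.\<close>
    have "Stirling (ms 1) 0 = 0" using \<open>ms 1 \<noteq> 0\<close> by (cases "ms 1") auto
    then show "\<forall>Q\<in>Pow P - ?\<F>. F Q = 0" by (auto simp: F_def)
  qed (use finP in auto)
  also have "\<dots> = (\<Sum>r=1..m. \<Sum>Q | Q \<in> ?\<F> \<and> card Q = r. F Q)"
  proof (rule sum.group[symmetric])
    have "0 < card Q \<and> card Q \<le> m" if "Q \<in> ?\<F>" for Q
      using that finP cardP card_mono[of P Q] finite_subset[of Q P]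
      by (auto simp: card_gt_0_iff blocks_of_size_def)
    then show "card ` ?\<F> \<subseteq> {1..m}" by force
  qed (use finP in auto)
  also have "\<dots> = (\<Sum>r=1..m. \<Sum>Q | Q \<in> subpartitions r P \<and> blocks_of_size Q (n 1) \<noteq> {}. F Q)"
    by (intro sum.cong) (auto simp: subpartitions_def)
  finally show ?thesis by (simp only: F_def Let_def)
qed

end
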